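(* Let $n\ge 1$ be an integer and let $f:\mathbb R^{n\times n}\to\mathbb R$ be twice continuously differentiable. Assume there is a symmetric positive semidefinite matrix $M^*\in\mathbb R^{n\times n}$ with $\operatorname{rank}(M^* )\le 1$ that is a global minimizer of $f$ over $\mathbb R^{n\times n}$. Suppose that $f$ satisfies the $\delta$-$\mathrm{RIP}_{2}$ property and the $\kappa$-$\mathrm{BDP}_{2}$ property for some constants $\delta\in[0,1)$ and $\kappa\ge 0$ such that $$\delta<\frac{2-6(1+\sqrt 2)\kappa}{4+6(1+\sqrt 2)\kappa}.$$ Then the problem $$\min_{x\in\mathbb R^{n}} f(xx^T)$$ has no spurious local minima, i.e., every local minimizer of $x\mapsto f(xx^T)$ on $\mathbb R^n$ is a global minimizer of it.
   Context: For $M\in\mathbb R^{n\times n}$ the Hessian $\nabla^2 f(M)$ is regarded as the bilinear (quadratic) form $[\nabla^2 f(M)](K,L)=\sum_{i,j,k,l=1}^n \frac{\partial^2 f}{\partial M_{ij}\partial M_{kl}}(M)K_{ij}L_{kl}$ for $K,L\in\mathbb R^{n\times n}$. $\|\cdot\|_F$ is the Frobenius norm. $\delta$-$\mathrm{RIP}_{2}$ (for $\delta\in[0,1)$): $(1-\delta)\|K\|_F^2\le[\nabla^2 f(M)](K,K)\le(1+\delta)\|K\|_F^2$ for all $M,K\in\mathbb R^{n\times n}$ with $\operatorname{rank}(M)\le 2$ and $\operatorname{rank}(K)\le 2$. $\kappa$-$\mathrm{BDP}_{2}$ (for $\kappa\ge 0$): $|[\nabla^2 f(M)-\nabla^2 f(M')](K,L)|\le\kappa\|K\|_F\|L\|_F$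 for all $M,M',K,L\in\mathbb R^{n\times n}$ of rank at most $2$. A spurious local minimum is a local minimum that is not a global minimum. *)

theory Defs
  imports "HOL-Analysis.Analysis"
begin

text \<open>Twice continuous Frechet differentiability on the whole space: the derivative
  \<open>f'\<close> takes values in the dual space, the second derivative \<open>f''\<close> in the space
  of bounded linear maps into the dual, both with the operator norm.\<close>

definition twice_cont_differentiable :: "('a::real_normed_vector \<Rightarrow> real) \<Rightarrow> bool" where
  "twice_cont_differentiable f \<longleftrightarrow>
     (\<exists>(f' :: 'a \<Rightarrow> 'a \<Rightarrow>\<^sub>L real) (f'' :: 'a \<Rightarrow> 'a \<Rightarrow>\<^sub>L ('a \<Rightarrow>\<^sub>L real)).
        (\<forall>M. (f has_derivative blinfun_apply (f' M)) (at M)) \<and>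
        (\<forall>M. (f' has_derivative blinfun_apply (f'' M)) (at M)) \<and>
        continuous_on UNIV f'')"

text \<open>\<open>partial_entry i j f M\<close> is the partial derivative of \<open>f\<close> in the entry \<open>(i, j)\<close>,
  taken at \<open>M\<close>; \<open>axis i (axis j 1)\<close> is the matrix whose only nonzero entry is a 1 there.\<close>

definition partial_entry ::
    "'n \<Rightarrow> 'n \<Rightarrow> (real^'n^'n \<Rightarrow> real) \<Rightarrow> real^'n^'n \<Rightarrow> real" where
  "partial_entry i j f M = deriv (\<lambda>t. f (M + t *\<^sub>R axis i (axis j 1))) 0"

definition hessian ::
    "(real^'n^'n \<Rightarrow> real) \<Rightarrow> real^'n^'n \<Rightarrow> real^'n^'n \<Rightarrow> real^'n^'n \<Rightarrow> real" where
  "hessian f M K L =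
     (\<Sum>i\<in>UNIV. \<Sum>j\<in>UNIV. \<Sum>k\<in>UNIV. \<Sum>l\<in>UNIV.
        partial_entry i j (partial_entry k l f) M * K $ i $ j * L $ k $ l)"

text \<open>The library norm on \<open>real^'n^'n\<close> is the Frobenius norm, not an operator norm.\<close>

lemma norm_matrix_eq_frobenius:
  fixes K :: "real^'n^'n"
  shows "norm K = sqrt (\<Sum>i\<in>UNIV. \<Sum>j\<in>UNIV. (K $ i $ j)\<^sup>2)"
  by (simp add: norm_vec_def L2_set_def sum_nonneg)

definition RIP2 :: "real \<Rightarrow> (real^'n^'n \<Rightarrow> real) \<Rightarrow> bool" where
  "RIP2 \<delta> f \<longleftrightarrow>
     (\<forall>M K. rank M \<le> 2 \<longrightarrow> rank K \<le> 2 \<longrightarrow>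
        (1 - \<delta>) * (norm K)\<^sup>2 \<le> hessian f M K K \<and>
        hessian f M K K \<le> (1 + \<delta>) * (norm K)\<^sup>2)"

definition BDP2 :: "real \<Rightarrow> (real^'n^'n \<Rightarrow> real) \<Rightarrow> bool" where
  "BDP2 \<kappa> f \<longleftrightarrow>
     (\<forall>M M' K L. rank M \<le> 2 \<longrightarrow> rank M' \<le> 2 \<longrightarrow> rank K \<le> 2 \<longrightarrow> rank L \<le> 2 \<longrightarrow>
        \<bar>hessian f M K L - hessian f M' K L\<bar> \<le> \<kappa> * norm K * norm L)"

definition sym_psd :: "real^'n^'n \<Rightarrow> bool" where
  "sym_psd M \<longleftrightarrow> transpose M = M \<and> (\<forall>x. 0 \<le> x \<bullet> (M *v x))"

definition outer_self :: "real^'n \<Rightarrow> real^'n^'n" where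
  "outer_self x = (columnvector x :: real^1^'n) ** (rowvector x :: real^'n^1)"

definition global_minimizer :: "('a \<Rightarrow> real) \<Rightarrow> 'a \<Rightarrow> bool" where
  "global_minimizer g x \<longleftrightarrow> (\<forall>y. g x \<le> g y)"

definition local_minimizer :: "('a::metric_space \<Rightarrow> real) \<Rightarrow> 'a \<Rightarrow> bool" where
  "local_minimizer g x \<longleftrightarrow> (\<exists>e>0. \<forall>y. dist y x < e \<longrightarrow> g x \<le> g y)"

end

theory Submission
  imports Defs
begin

text \<open>
  The bound on \<open>\<delta>\<close> forces \<open>\<delta> < 1/2\<close>, and below \<open>1/2\<close> every local minimizer \<open>x\<close> of the
  factored problem satisfies \<open>x x\<^sup>T = M\<^sup>*\<close>, where \<open>M\<^sup>* = z z\<^sup>T\<close>.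

  Write \<open>z = \<beta> x + w\<close> with \<open>w\<close> orthogonal to \<open>x\<close>.  The matrices whose range lies in the span
  of \<open>x\<close> and \<open>w\<close> form a linear space \<open>S\<close> that contains \<open>x x\<^sup>T\<close> and \<open>z z\<^sup>T\<close>, and they all
  have rank at most 2.  So the restricted isometry property makes \<open>f\<close> on \<open>S\<close> a function whose
  Hessian lies between \<open>1 - \<delta>\<close> and \<open>1 + \<delta>\<close> times the identity.  As the gradient vanishes at
  \<open>z z\<^sup>T\<close>, the gradient \<open>G\<close> at \<open>x x\<^sup>T\<close> is close on \<open>S\<close> to the error \<open>E = x x\<^sup>T - z z\<^sup>T\<close>:
  \<open>\<bar>G(N) - \<langle>E, N\<rangle>\<bar> \<le> \<delta> \<parallel>E\<parallel> \<parallel>N\<parallel>\<close> (\<open>restricted_gradient_near_identity\<close>).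

  The necessary conditions at \<open>x\<close> (\<open>factored_local_min_conditions\<close>) pull the other way.  To
  first order \<open>G\<close> kills \<open>x x\<^sup>T\<close> and \<open>x w\<^sup>T + w x\<^sup>T\<close>, so the component of \<open>G\<close> in the symmetric
  part of \<open>S\<close> is a multiple \<open>- (g / r) w w\<^sup>T\<close>, with \<open>r = \<parallel>w\<parallel>\<^sup>2\<close>.  To second order the
  curvature along \<open>x w\<^sup>T + w x\<^sup>T\<close>, at most \<open>2 (1 + \<delta>) \<parallel>x\<parallel>\<^sup>2 r\<close>, compensates
  \<open>2 G(w w\<^sup>T) = - 2 g r\<close>, so \<open>g \<le> (1 + \<delta>) \<parallel>x\<parallel>\<^sup>2\<close>.  Testing the closeness of \<open>G\<close> to \<open>E\<close> on
  \<open>N = - (g / r) w w\<^sup>T - E\<close>, the difference of the two, leaves a quadratic inequality in the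
  real numbers \<open>g\<close>, \<open>r\<close>, \<open>\<parallel>x\<parallel>\<^sup>2\<close> and \<open>\<beta>\<close> that has no solution for \<open>\<delta> < 1/2\<close>
  (\<open>rank1_threshold\<close>), unless \<open>w = 0\<close>; and then \<open>G(E) = 0\<close> gives \<open>E = 0\<close>.
\<close>

section \<open>Gradients under a restricted isometry of the Hessian\<close>

text \<open>The segment from \<open>M\<close> to \<open>M + K\<close> stays in \<open>S\<close>, so the Lagrange remainder of second order
  along it is controlled by the curvature bounds on \<open>S\<close>.\<close>

lemma restricted_taylor_bounds:
  fixes f :: "'a::real_inner \<Rightarrow> real"
    and f' :: "'a \<Rightarrow> 'a \<Rightarrow>\<^sub>L real" and f'' :: "'a \<Rightarrow> 'a \<Rightarrow>\<^sub>L ('a \<Rightarrow>\<^sub>L real)"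
  assumes f': "\<And>M. (f has_derivative f' M) (at M)"
    and f'': "\<And>M. (f' has_derivative f'' M) (at M)"
    and S: "subspace S"
    and rip: "\<And>M K. M \<in> S \<Longrightarrow> K \<in> S \<Longrightarrow>
        l * (norm K)\<^sup>2 \<le> f'' M K K \<and> f'' M K K \<le> u * (norm K)\<^sup>2"
    and M: "M \<in> S" and K: "K \<in> S"
  shows "l / 2 * (norm K)\<^sup>2 \<le> f (M + K) - f M - f' M K"
    and "f (M + K) - f M - f' M K \<le> u / 2 * (norm K)\<^sup>2"
proof -
  define diff where "diff m t = (if m = 0 then f (M + t *\<^sub>R K) else
      if m = 1 then f' (M + t *\<^sub>R K) K else f'' (M + t *\<^sub>R K) K K)" for m :: nat and t :: real
  have d0: "((\<lambda>t. f (M + t *\<^sub>R K)) has_real_derivative f' (M + t *\<^sub>R K) K) (at t)" for t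
    unfolding has_field_derivative_def
    by (rule has_derivative_eq_rhs[OF has_derivative_compose[OF _ f']])
       (auto intro!: derivative_eq_intros simp: blinfun.scaleR_right mult.commute)
  have d1: "((\<lambda>t. f' (M + t *\<^sub>R K) K) has_real_derivative f'' (M + t *\<^sub>R K) K K) (at t)" for t
  proof -
    have "((\<lambda>t. f' (M + t *\<^sub>R K)) has_derivative (\<lambda>s. f'' (M + t *\<^sub>R K) (s *\<^sub>R K))) (at t)"
      by (rule has_derivative_compose[OF _ f'']) (auto intro!: derivative_eq_intros)
    then have "((\<lambda>t. f' (M + t *\<^sub>R K) K) has_derivative (\<lambda>s. f'' (M + t *\<^sub>R K) (s *\<^sub>R K) K)) (at t)"
      by (auto intro!: derivative_eq_intros)
    then show ?thesis
      unfolding has_field_derivative_def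
      by (rule has_derivative_eq_rhs)
         (auto simp: blinfun.scaleR_right blinfun.scaleR_left mult.commute)
  qed
  have "\<exists>t>0. t < 1 \<and> diff 0 1 = (\<Sum>m<2. diff m 0 / fact m * 1 ^ m) + diff 2 t / fact 2 * 1 ^ 2"
    by (rule Maclaurin) (auto simp: diff_def less_2_cases_iff d0 d1)
  then obtain t where "f (M + K) = f M + f' M K + f'' (M + t *\<^sub>R K) K K / 2"
    by (auto simp: diff_def numeral_2_eq_2)
  moreover have "M + t *\<^sub>R K \<in> S"
    using M K S by (simp add: subspace_add subspace_scale)
  ultimately show "l / 2 * (norm K)\<^sup>2 \<le> f (M + K) - f M - f' M K"
    and "f (M + K) - f M - f' M K \<le> u / 2 * (norm K)\<^sup>2"
    using rip[of "M + t *\<^sub>R K" K] K by auto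
qed

text \<open>If the second derivatives on \<open>S\<close> all lie between \<open>1 - \<delta>\<close> and \<open>1 + \<delta>\<close> times the
  identity, so does their average over the segment from \<open>Z\<close> to \<open>M\<close>, and this average maps
  \<open>M - Z\<close> to the increment of the gradient; its distance to the identity has norm at most
  \<open>\<delta>\<close>.  The proof works with function values, as in the cocoercivity inequality for smooth
  convex functions: the Taylor bounds at \<open>M\<close> and at \<open>Z\<close> are compared at the two points
  \<open>M - K\<close> and \<open>Z + K\<close>.  Choosing \<open>K\<close> well polarizes the bounds on the diagonal values
  \<open>f'' M K K\<close> into one on the pairing of \<open>M - Z\<close> with \<open>N\<close>.\<close>

lemma restricted_gradient_near_identity:
  fixes f :: "'a::real_inner \<Rightarrow> real"
    and f' :: "'a \<Rightarrow> 'a \<Rightarrow>\<^sub>L real" and f'' :: "'a \<Rightarrow> 'a \<Rightarrow>\<^sub>L ('a \<Rightarrow>\<^sub>L real)"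
  assumes f': "\<And>M. (f has_derivative f' M) (at M)"
    and f'': "\<And>M. (f' has_derivative f'' M) (at M)"
    and S: "subspace S"
    and rip: "\<And>M K. M \<in> S \<Longrightarrow> K \<in> S \<Longrightarrow>
        (1 - \<delta>) * (norm K)\<^sup>2 \<le> f'' M K K \<and> f'' M K K \<le> (1 + \<delta>) * (norm K)\<^sup>2"
    and Z: "Z \<in> S" "f' Z = 0" and M: "M \<in> S" and N: "N \<in> S"
  shows "\<bar>f' M N - (M - Z) \<bullet> N\<bar> \<le> \<delta> * norm (M - Z) * norm N"
proof -
  define E where "E = M - Z"
  have E: "E \<in> S" using M Z S by (simp add: E_def subspace_diff)
  note bounds = restricted_taylor_bounds[OF f' f'' S rip]
  have unscaled: "f' M P \<le> E \<bullet> P + \<delta> / 2 * ((norm E)\<^sup>2 + (norm P)\<^sup>2)" if P: "P \<in> S" for P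
  proof -
    \<comment> \<open>chosen so that \<open>2 K - E = P\<close>, the direction in which the four bounds below test \<open>f' M\<close>\<close>
    define K where "K = (1/2) *\<^sub>R (E + P)"
    have K: "K \<in> S" using E P S by (simp add: K_def subspace_add subspace_scale)
    have neg: "- K \<in> S" and EK: "E - K \<in> S" "K - E \<in> S"
      using S K E by (simp_all add: subspace_neg subspace_diff)
    have at_Y: "M - K = Z + (E - K)" "Z + K = M + (K - E)" by (simp_all add: E_def)
    have "f (M - K) \<le> f M - f' M K + (1 + \<delta>) / 2 * (norm K)\<^sup>2"
      using bounds(2)[OF _ _ M neg] by (simp add: blinfun.minus_right)
    moreover have "f Z + (1 - \<delta>) / 2 * (norm (E - K))\<^sup>2 \<le> f (M - K)"
      using bounds(1)[OF _ _ Z(1) EK(1)] by (simp add: at_Y Z(2))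
    moreover have "f (Z + K) \<le> f Z + (1 + \<delta>) / 2 * (norm K)\<^sup>2"
      using bounds(2)[OF _ _ Z(1) K] by (simp add: Z(2))
    moreover have "f M + f' M (K - E) + (1 - \<delta>) / 2 * (norm (E - K))\<^sup>2 \<le> f (Z + K)"
      using bounds(1)[OF _ _ M EK(2)] by (simp add: at_Y norm_minus_commute)
    ultimately have "f' M (K - E) + f' M K \<le> (1 + \<delta>) * (norm K)\<^sup>2 - (1 - \<delta>) * (norm (E - K))\<^sup>2"
      by (simp add: field_simps)
    moreover have "f' M (K - E) + f' M K = f' M P"
    proof -
      have "K - E + K = P" by (simp add: K_def algebra_simps flip: scaleR_add_left)
      then show ?thesis by (metis blinfun.add_right)
    qed
    moreover have "(norm K)\<^sup>2 = ((norm E)\<^sup>2 + 2 * (E \<bullet> P) + (norm P)\<^sup>2) / 4"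
      by (simp add: K_def power2_norm_eq_inner inner_simps inner_commute field_simps)
    moreover have "(norm (E - K))\<^sup>2 = ((norm E)\<^sup>2 - 2 * (E \<bullet> P) + (norm P)\<^sup>2) / 4"
    proof -
      have "E - K = (1/2) *\<^sub>R (E - P)"
        by (simp add: K_def algebra_simps flip: scaleR_add_left)
      then show ?thesis
        by (simp only:) (simp add: power2_norm_eq_inner inner_simps inner_commute field_simps)
    qed
    ultimately show ?thesis by (simp add: field_simps)
  qed
  have half: "f' M N - E \<bullet> N \<le> \<delta> * norm E * norm N" if N: "N \<in> S" for N
  proof (cases "E = 0 \<or> N = 0")
    case True
    then show ?thesis using Z(2) by (auto simp: E_def)
  next
    case False
    \<comment> \<open>rescaling \<open>N\<close> to the length of \<open>E\<close> turns the arithmetic mean of the squares into a product\<close>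
    define s where "s = norm E / norm N"
    have s: "s > 0" using False by (simp add: s_def)
    have "f' M (s *\<^sub>R N) \<le> E \<bullet> (s *\<^sub>R N) + \<delta> / 2 * ((norm E)\<^sup>2 + (norm (s *\<^sub>R N))\<^sup>2)"
      by (rule unscaled) (simp add: N S subspace_scale)
    moreover have "norm (s *\<^sub>R N) = norm E" "(norm E)\<^sup>2 = s * (norm E * norm N)"
      using False by (simp_all add: s_def power2_eq_square)
    ultimately have "f' M (s *\<^sub>R N) \<le> E \<bullet> (s *\<^sub>R N) + \<delta> * (s * (norm E * norm N))"
      by (simp only:) simp
    then have "s * f' M N \<le> s * (E \<bullet> N + \<delta> * norm E * norm N)"
      by (simp add: blinfun.scaleR_right algebra_simps)
    then show ?thesis using s by simp
  qed
  show ?thesis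
    using half[OF N] half[of "- N"] N S
    by (auto simp: E_def[symmetric] blinfun.minus_right subspace_neg abs_le_iff)
qed

section \<open>Second-order conditions for local minima\<close>

lemma local_min_second_order:
  fixes g g' :: "real \<Rightarrow> real"
  assumes g: "\<And>t. (g has_real_derivative g' t) (at t)"
    and g': "(g' has_real_derivative c) (at 0)"
    and e: "e > 0" and min: "\<And>t. \<bar>t\<bar> < e \<Longrightarrow> g 0 \<le> g t"
  shows "g' 0 = 0" and "c \<ge> 0"
proof -
  show zero: "g' 0 = 0"
    by (rule DERIV_local_min[OF g e]) (auto intro: min)
  show "c \<ge> 0"
  proof (rule ccontr)
    assume "\<not> c \<ge> 0"
    then obtain d where d: "d > 0" "\<And>h. h > 0 \<Longrightarrow> h < d \<Longrightarrow> g' h < 0"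
      using DERIV_neg_dec_right[OF g'] zero by auto
    define h where "h = min d e / 2"
    have h: "0 < h" "h < d" "h < e" using d(1) e by (auto simp: h_def)
    obtain t where t: "0 < t" "t < h" "g h - g 0 = (h - 0) * g' t"
      using MVT2[OF h(1), of g g'] g by blast
    have "g h < g 0" using t h d(2)[of t] mult_pos_neg[of h "g' t"] by auto
    then show False using min[of h] h by auto
  qed
qed

section \<open>Outer products\<close>

definition outer :: "real^'n \<Rightarrow> real^'m \<Rightarrow> real^'m^'n" where
  "outer a b = (\<chi> i j. a $ i * b $ j)"

lemma outer_self_eq: "outer_self x = outer x x"
  by (simp add: outer_self_def outer_def columnvector_def rowvector_def matrix_matrix_mult_def
      vec_eq_iff)

lemma outer_add_left: "outer (a + b) c = outer a c + outer b c"
  and outer_add_right: "outer c (a + b) = outer c a + outer c b"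
  and outer_scale_left: "outer (r *\<^sub>R a) c = r *\<^sub>R outer a c"
  and outer_scale_right: "outer c (r *\<^sub>R a) = r *\<^sub>R outer c a"
  by (simp_all add: outer_def vec_eq_iff algebra_simps)

lemmas outer_simps = outer_add_left outer_add_right outer_scale_left outer_scale_right

lemma outer_mult_vec: "outer a b *v y = (b \<bullet> y) *\<^sub>R a"
  by (simp add: outer_def matrix_vector_mult_def inner_vec_def vec_eq_iff sum_distrib_left mult_ac)

lemma inner_outer: "outer a b \<bullet> outer c d = (a \<bullet> c) * (b \<bullet> d)"
proof -
  have "outer a b \<bullet> outer c d = (\<Sum>i\<in>UNIV. \<Sum>j\<in>UNIV. (a $ i * c $ i) * (b $ j * d $ j))"
    by (simp add: outer_def inner_vec_def mult_ac)
  also have "\<dots> = (a \<bullet> c) * (b \<bullet> d)"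
    by (simp add: inner_vec_def sum_product)
  finally show ?thesis .
qed

text \<open>The linear spaces of matrices on which the restricted isometry acts as a bound on the
  whole Hessian: for \<open>V\<close> of dimension 2 every member has rank at most 2.\<close>

definition range_within :: "(real^'n) set \<Rightarrow> (real^'m^'n) set" where
  "range_within V = {K. range ((*v) K) \<subseteq> V}"

lemma subspace_range_within: "subspace V \<Longrightarrow> subspace (range_within V)"
  by (auto simp: range_within_def image_subset_iff matrix_vector_mult_add_rdistrib
      scaleR_matrix_vector_assoc[symmetric]
      intro!: subspaceI subspace_add[of V] subspace_scale[of V] intro: subspace_0)

lemma outer_in_range_within: "subspace V \<Longrightarrow> a \<in> V \<Longrightarrow> outer a b \<in> range_within V"
  by (auto simp: range_within_def outer_mult_vec subspace_scale)

lemma rank_range_within_span2: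
  assumes "K \<in> range_within (span {a, b})"
  shows "rank K \<le> 2"
proof -
  have "rank K \<le> card {a, b}"
    unfolding rank_dim_range
    using assms by (intro dim_le_card) (auto simp: range_within_def)
  also have "\<dots> \<le> 2" by (simp add: card_insert_if)
  finally show ?thesis .
qed

text \<open>A matrix of rank at most 1 has the form \<open>y \<mapsto> c(y) v\<close>.  Symmetry forces \<open>c\<close> to be a
  multiple of \<open>y \<mapsto> v \<bullet> y\<close>, and semidefiniteness makes the factor nonnegative, so that its
  square root can be absorbed into \<open>v\<close>.\<close>

lemma sym_psd_rank1_outer:
  fixes M :: "real^'n^'n"
  assumes "sym_psd M" and "rank M \<le> 1"
  obtains z where "M = outer z z"
proof -
  have sym: "(M *v x) \<bullet> y = x \<bullet> (M *v y)" for x y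
    using assms(1) dot_lmul_matrix[of x M y] by (simp add: sym_psd_def transpose_matrix_vector[symmetric])
  have "\<exists>v. range ((*v) M) \<subseteq> span {v}"
  proof -
    obtain B where B: "range ((*v) M) \<subseteq> span B" "independent B" "card B = dim (range ((*v) M))"
      using basis_exists by metis
    have "card B \<le> 1" "finite B" using B assms(2) by (auto simp: rank_dim_range independent_imp_finite)
    then consider "B = {}" | v where "B = {v}"
      by (metis card_0_eq card_1_singletonE le_Suc_eq One_nat_def le_zero_eq)
    then show ?thesis
    proof cases
      case 1
      then show ?thesis using B(1) by (intro exI[of _ 0]) simp
    qed (use B(1) in blast)
  qed
  then obtain v where v: "range ((*v) M) \<subseteq> span {v}" by blast
  then have "\<exists>c. \<forall>y. M *v y = c y *\<^sub>R v"
    by (intro choice) (auto simp: span_singleton)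
  then obtain c where c: "\<And>y. M *v y = c y *\<^sub>R v" by blast
  show ?thesis
  proof (cases "v = 0")
    case True
    then have "M = outer 0 0" using c by (simp add: matrix_eq outer_mult_vec)
    then show ?thesis by (rule that)
  next
    case False
    then have vv: "v \<bullet> v > 0" by simp
    define s where "s = c v / (v \<bullet> v)"
    have "0 \<le> v \<bullet> (M *v v)" using assms(1) by (simp add: sym_psd_def)
    then have s: "s \<ge> 0" using vv by (simp add: c s_def zero_le_mult_iff)
    have "c y = s * (v \<bullet> y)" for y
      using sym[of v y] vv by (simp add: c s_def field_simps)
    then have "M = outer (sqrt s *\<^sub>R v) (sqrt s *\<^sub>R v)"
      using s by (simp add: matrix_eq outer_mult_vec c)
    then show ?thesis by (rule that)
  qed
qed

section \<open>The Hessian as a second derivative\<close>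

lemma matrix_axis_expansion:
  fixes K :: "real^'m^'n"
  shows "K = (\<Sum>i\<in>UNIV. \<Sum>j\<in>UNIV. K $ i $ j *\<^sub>R axis i (axis j (1::real)))"
proof -
  have "axis i (axis j 1) $ a $ b = (if j = b then if i = a then 1 else 0 else (0::real))"
    for i a :: 'n and j b :: 'm
    by (simp add: axis_def zero_vec_def)
  then show ?thesis by (simp add: vec_eq_iff if_distrib[of "\<lambda>x. _ * x"] cong: if_cong)
qed

lemma hessian_eq_second_derivative:
  fixes f :: "real^'n^'n \<Rightarrow> real"
    and f' :: "real^'n^'n \<Rightarrow> (real^'n^'n) \<Rightarrow>\<^sub>L real"
    and f'' :: "real^'n^'n \<Rightarrow> (real^'n^'n) \<Rightarrow>\<^sub>L ((real^'n^'n) \<Rightarrow>\<^sub>L real)"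
  assumes f': "\<And>M. (f has_derivative f' M) (at M)"
    and f'': "\<And>M. (f' has_derivative f'' M) (at M)"
  shows "hessian f M K L = f'' M K L"
proof -
  have partial: "partial_entry i j g M = g' (axis i (axis j 1))"
    if "(g has_derivative g') (at M)" for g g' i j and M :: "real^'n^'n"
  proof -
    let ?e = "axis i (axis j 1) :: real^'n^'n"
    have "((\<lambda>t. g (M + t *\<^sub>R ?e)) has_derivative (\<lambda>s. g' (s *\<^sub>R ?e))) (at 0)"
      by (rule has_derivative_compose[where g = g])
         (use that in \<open>auto intro!: derivative_eq_intros\<close>)
    moreover have "g' (s *\<^sub>R ?e) = s * g' ?e" for s
      using has_derivative_linear[OF that] by (simp add: linear_cmul)
    ultimately show ?thesis
      unfolding partial_entry_def
      by (intro DERIV_imp_deriv) (simp add: has_field_derivative_def mult_commute_abs)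
  qed
  have "partial_entry k l f = (\<lambda>M. f' M (axis k (axis l 1)))" for k l
    using partial[OF f'] by blast
  moreover have "partial_entry i j (\<lambda>M. f' M e) M = f'' M (axis i (axis j 1)) e" for i j e
    by (rule partial) (auto intro!: derivative_eq_intros f'')
  ultimately have "hessian f M K L = (\<Sum>i\<in>UNIV. \<Sum>j\<in>UNIV. \<Sum>k\<in>UNIV. \<Sum>l\<in>UNIV.
      f'' M (axis i (axis j 1)) (axis k (axis l 1)) * K $ i $ j * L $ k $ l)"
    unfolding hessian_def by simp
  also have "\<dots> = f'' M (\<Sum>i\<in>UNIV. \<Sum>j\<in>UNIV. K $ i $ j *\<^sub>R axis i (axis j 1))
      (\<Sum>k\<in>UNIV. \<Sum>l\<in>UNIV. L $ k $ l *\<^sub>R axis k (axis l 1))"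
    unfolding blinfun.sum_right[of "f'' M"] blinfun.sum_left
    by (simp add: blinfun.sum_right blinfun.scaleR_right blinfun.scaleR_left
        sum_distrib_left mult_ac)
  also have "\<dots> = f'' M K L"
    by (simp flip: matrix_axis_expansion)
  finally show ?thesis .
qed

section \<open>Critical points of the factored objective\<close>

text \<open>Along the line \<open>x + t u\<close> the product is \<open>x x\<^sup>T + t U + t\<^sup>2 u u\<^sup>T\<close>.  The first derivative
  of \<open>f\<close> on this curve at \<open>t = 0\<close> sees only \<open>U\<close>; the second one also sees the acceleration
  \<open>2 u u\<^sup>T\<close> of the curve through the gradient.\<close>

lemma factored_local_min_conditions:
  fixes f :: "real^'n^'n \<Rightarrow> real"
    and f' :: "real^'n^'n \<Rightarrow> (real^'n^'n) \<Rightarrow>\<^sub>L real"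
    and f'' :: "real^'n^'n \<Rightarrow> (real^'n^'n) \<Rightarrow>\<^sub>L ((real^'n^'n) \<Rightarrow>\<^sub>L real)"
  assumes f': "\<And>M. (f has_derivative f' M) (at M)"
    and f'': "\<And>M. (f' has_derivative f'' M) (at M)"
    and min: "local_minimizer (\<lambda>x. f (outer x x)) x"
  defines "U \<equiv> \<lambda>u. outer x u + outer u x"
  shows "f' (outer x x) (U u) = 0"
    and "0 \<le> f'' (outer x x) (U u) (U u) + 2 * f' (outer x x) (outer u u)"
proof -
  define X where "X t = outer x x + t *\<^sub>R U u + t\<^sup>2 *\<^sub>R outer u u" for t
  define X' where "X' t = U u + (2 * t) *\<^sub>R outer u u" for t :: real
  have X: "X t = outer (x + t *\<^sub>R u) (x + t *\<^sub>R u)" for t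
    by (simp add: X_def U_def outer_simps algebra_simps power2_eq_square)
  have X_deriv: "(X has_derivative (\<lambda>s. s *\<^sub>R X' t)) (at t)" for t
    unfolding X_def X'_def
    by (auto intro!: derivative_eq_intros simp: algebra_simps)
  have g: "((\<lambda>t. f (X t)) has_real_derivative f' (X t) (X' t)) (at t)" for t
    unfolding has_field_derivative_def
    by (rule has_derivative_eq_rhs[OF has_derivative_compose[OF X_deriv f']])
       (auto simp: blinfun.scaleR_right mult.commute)
  have g': "((\<lambda>t. f' (X t) (X' t)) has_real_derivative
      f'' (X 0) (U u) (U u) + 2 * f' (X 0) (outer u u)) (at 0)"
  proof -
    have "((\<lambda>t. f' (X t)) has_derivative (\<lambda>s. f'' (X 0) (s *\<^sub>R X' 0))) (at 0)"
      by (rule has_derivative_compose[OF X_deriv f''])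
    moreover have "(X' has_derivative (\<lambda>s. (2 * s) *\<^sub>R outer u u)) (at 0)"
      unfolding X'_def by (auto intro!: derivative_eq_intros)
    ultimately have "((\<lambda>t. f' (X t) (X' t)) has_derivative
        (\<lambda>s. f' (X 0) ((2 * s) *\<^sub>R outer u u) + f'' (X 0) (s *\<^sub>R X' 0) (X' 0))) (at 0)"
      by (rule blinfun.FDERIV)
    then show ?thesis
      unfolding has_field_derivative_def
      by (rule has_derivative_eq_rhs)
         (auto simp: X'_def blinfun.scaleR_right blinfun.scaleR_left algebra_simps)
  qed
  obtain e where e: "e > 0" "\<And>y. dist y x < e \<Longrightarrow> f (outer x x) \<le> f (outer y y)"
    using min by (auto simp: local_minimizer_def)
  define d where "d = e / (norm u + 1)"
  have pos: "norm u + 1 > 0" by (simp add: add_nonneg_pos)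
  then have "d > 0" using e by (simp add: d_def)
  moreover have "f (X 0) \<le> f (X t)" if "\<bar>t\<bar> < d" for t
  proof -
    have "\<bar>t\<bar> * norm u \<le> \<bar>t\<bar> * (norm u + 1)" by (simp add: mult_left_mono)
    also have "\<dots> < e" using that pos by (simp add: d_def field_simps)
    finally show ?thesis unfolding X using e(2)[of "x + t *\<^sub>R u"] by (simp add: dist_norm)
  qed
  ultimately have "f' (X 0) (X' 0) = 0" "0 \<le> f'' (X 0) (U u) (U u) + 2 * f' (X 0) (outer u u)"
    using local_min_second_order[OF g g'] by blast+
  then show "f' (outer x x) (U u) = 0"
    and "0 \<le> f'' (outer x x) (U u) (U u) + 2 * f' (outer x x) (outer u u)"
    by (simp_all add: X_def X'_def)
qed

text \<open>With \<open>p = \<parallel>x\<parallel>\<^sup>2\<close>, \<open>q = \<parallel>\<beta> x\<parallel>\<^sup>2\<close> and \<open>r = \<parallel>w\<parallel>\<^sup>2\<close>, the factor next to \<open>1 - \<delta>\<^sup>2\<close> is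
  \<open>\<parallel>x x\<^sup>T - z z\<^sup>T\<parallel>\<^sup>2\<close>.  Its minimum over \<open>q \<ge> 0\<close> is attained at \<open>q = 0\<close> if \<open>p \<le> r\<close>, and at
  \<open>q = p - r\<close> otherwise.  In the second case the discriminant in \<open>g\<close> is already negative for
  \<open>\<delta>\<^sup>2 < 1/2\<close>.  In the first case \<open>p\<close> is bounded below by \<open>g / (1 + \<delta>)\<close>, and the resulting
  quadratic in \<open>g\<close> has a discriminant with the sign of \<open>2 \<delta> - 1\<close>: this is where the threshold
  \<open>1/2\<close> comes from.\<close>

lemma rank1_threshold:
  fixes p q r g \<delta> :: real
  assumes p: "0 \<le> p" and q: "0 \<le> q" and r: "0 < r" and \<delta>: "0 \<le> \<delta>" "\<delta> < 1/2"
    and g: "g \<le> (1 + \<delta>) * p"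
  shows "0 < g\<^sup>2 - 2 * g * r + (1 - \<delta>\<^sup>2) * ((p - q)\<^sup>2 + 2 * q * r + r\<^sup>2)"
proof (rule ccontr)
  assume "\<not> ?thesis"
  then have le: "g\<^sup>2 - 2 * g * r + (1 - \<delta>\<^sup>2) * ((p - q)\<^sup>2 + 2 * q * r + r\<^sup>2) \<le> 0" by simp
  have \<delta>2: "\<delta>\<^sup>2 < 1/4"
    using power_strict_mono[OF \<delta>(2) \<delta>(1), of 2] by (simp add: power2_eq_square)
  show False
  proof (cases "p \<le> r")
    case True
    have "(p - q)\<^sup>2 + 2 * q * r + r\<^sup>2 = p\<^sup>2 + q\<^sup>2 + 2 * q * (r - p) + r\<^sup>2"
      by (simp add: power2_eq_square algebra_simps)
    then have "p\<^sup>2 + r\<^sup>2 \<le> (p - q)\<^sup>2 + 2 * q * r + r\<^sup>2" using True q by simp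
    then have "(1 - \<delta>\<^sup>2) * (p\<^sup>2 + r\<^sup>2) \<le> (1 - \<delta>\<^sup>2) * ((p - q)\<^sup>2 + 2 * q * r + r\<^sup>2)"
      using \<delta>2 by (intro mult_left_mono) auto
    with le have le': "g\<^sup>2 - 2 * g * r + (1 - \<delta>\<^sup>2) * (p\<^sup>2 + r\<^sup>2) \<le> 0" by linarith
    have "0 < (1 - \<delta>\<^sup>2) * (p\<^sup>2 + r\<^sup>2)" using \<delta>2 r by (intro mult_pos_pos add_nonneg_pos) auto
    with le' have "0 < g * r" using zero_le_power2[of g] by linarith
    then have g0: "0 < g" using r by (simp add: zero_less_mult_iff)
    have "g\<^sup>2 \<le> ((1 + \<delta>) * p)\<^sup>2" using g g0 by (intro power_mono) auto
    then have "(1 - \<delta>) * g\<^sup>2 \<le> (1 - \<delta>) * ((1 + \<delta>) * p)\<^sup>2"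
      using \<delta> by (intro mult_left_mono) auto
    also have "\<dots> = (1 + \<delta>) * ((1 - \<delta>\<^sup>2) * p\<^sup>2)"
      by (simp add: power2_eq_square algebra_simps)
    finally have gp: "(1 - \<delta>) * g\<^sup>2 \<le> (1 + \<delta>) * ((1 - \<delta>\<^sup>2) * p\<^sup>2)" .
    define Q where "Q = 2 * g\<^sup>2 - 2 * (1 + \<delta>) * g * r + (1 + \<delta>) * (1 - \<delta>\<^sup>2) * r\<^sup>2"
    have "Q \<le> (1 + \<delta>) * (g\<^sup>2 - 2 * g * r + (1 - \<delta>\<^sup>2) * (p\<^sup>2 + r\<^sup>2))"
      using gp by (simp add: Q_def algebra_simps)
    also have "\<dots> \<le> 0"
      using le' \<delta> by (simp add: mult_le_0_iff)
    finally have "Q \<le> 0" .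
    moreover have "2 * Q = (2 * g - (1 + \<delta>) * r)\<^sup>2 + (1 + \<delta>)\<^sup>2 * (1 - 2 * \<delta>) * r\<^sup>2"
      by (simp add: Q_def power2_eq_square algebra_simps)
    moreover have "0 < (1 + \<delta>)\<^sup>2 * (1 - 2 * \<delta>) * r\<^sup>2" using \<delta> r by simp
    ultimately show False using zero_le_power2[of "2 * g - (1 + \<delta>) * r"] by linarith
  next
    case False
    have "(p - q)\<^sup>2 + 2 * q * r + r\<^sup>2 = (p - q - r)\<^sup>2 + 2 * p * r"
      by (simp add: power2_eq_square algebra_simps)
    moreover have "r\<^sup>2 \<le> p * r" using False r by (simp add: power2_eq_square)
    ultimately have "2 * r\<^sup>2 \<le> (p - q)\<^sup>2 + 2 * q * r + r\<^sup>2"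
      using zero_le_power2[of "p - q - r"] by linarith
    then have "(1 - \<delta>\<^sup>2) * (2 * r\<^sup>2) \<le> (1 - \<delta>\<^sup>2) * ((p - q)\<^sup>2 + 2 * q * r + r\<^sup>2)"
      using \<delta>2 by (intro mult_left_mono) auto
    moreover have "(g - r)\<^sup>2 + (1 - 2 * \<delta>\<^sup>2) * r\<^sup>2 = g\<^sup>2 - 2 * g * r + (1 - \<delta>\<^sup>2) * (2 * r\<^sup>2)"
      by (simp add: power2_eq_square algebra_simps)
    moreover have "0 < (1 - 2 * \<delta>\<^sup>2) * r\<^sup>2" using \<delta>2 r by simp
    ultimately show False using le zero_le_power2[of "g - r"] by linarith
  qed
qed

text \<open>The error \<open>E = x x\<^sup>T - z z\<^sup>T\<close> is squeezed between the closeness of the gradient to \<open>E\<close> and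
  the necessary conditions in the direction \<open>w\<close>, the part of \<open>z\<close> orthogonal to \<open>x\<close>.  Among all
  directions in the span of \<open>x\<close> and \<open>z\<close> this one makes the second-order condition strongest: a
  component along \<open>x\<close> adds curvature but leaves the gradient term unchanged.\<close>

lemma rank1_factored_local_min_exact:
  fixes f :: "real^'n^'n \<Rightarrow> real"
  assumes C2: "twice_cont_differentiable f"
    and glob: "global_minimizer f (outer z z)"
    and \<delta>: "0 \<le> \<delta>" "\<delta> < 1/2" and rip: "RIP2 \<delta> f"
    and loc: "local_minimizer (\<lambda>x. f (outer x x)) x"
  shows "outer x x = outer z z"
proof -
  obtain f' :: "real^'n^'n \<Rightarrow> (real^'n^'n) \<Rightarrow>\<^sub>L real"
    and f'' :: "real^'n^'n \<Rightarrow> (real^'n^'n) \<Rightarrow>\<^sub>L ((real^'n^'n) \<Rightarrow>\<^sub>L real)"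
    where f': "\<And>M. (f has_derivative f' M) (at M)"
      and f'': "\<And>M. (f' has_derivative f'' M) (at M)"
    using C2 unfolding twice_cont_differentiable_def by blast
  have grad0: "f' (outer z z) = 0"
  proof (rule blinfun_eqI)
    fix K
    have "blinfun_apply (f' (outer z z)) = (\<lambda>h. 0)"
      using glob by (intro has_derivative_local_min[OF f']) (auto simp: global_minimizer_def)
    then show "f' (outer z z) K = blinfun_apply 0 K" by simp
  qed
  \<comment> \<open>for \<open>x = 0\<close> the quotient is 0, so \<open>w = z\<close> and the argument below covers this case too\<close>
  define \<beta> where "\<beta> = (x \<bullet> z) / (x \<bullet> x)"
  define w where "w = z - \<beta> *\<^sub>R x"
  have z: "z = \<beta> *\<^sub>R x + w" by (simp add: w_def)
  have xw: "x \<bullet> w = 0" by (simp add: w_def \<beta>_def inner_simps)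
  then have wx: "w \<bullet> x = 0" by (simp add: inner_commute)
  define S :: "(real^'n^'n) set" where "S = range_within (span {x, w})"
  have S: "subspace S" unfolding S_def by (simp add: subspace_range_within)
  have x: "x \<in> span {x, w}" and w: "w \<in> span {x, w}" by (simp_all add: span_base)
  then have zS: "z \<in> span {x, w}" unfolding z by (simp add: span_add span_scale)
  have outer_S: "outer a b \<in> S" if "a \<in> span {x, w}" for a b
    unfolding S_def using that by (simp add: outer_in_range_within)
  have rip_S: "(1 - \<delta>) * (norm K)\<^sup>2 \<le> f'' M K K \<and> f'' M K K \<le> (1 + \<delta>) * (norm K)\<^sup>2"
    if "M \<in> S" "K \<in> S" for M K
    using rip that rank_range_within_span2[of M x w] rank_range_within_span2[of K x w]
    unfolding RIP2_def S_def hessian_eq_second_derivative[OF f' f''] by blast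
  define E where "E = outer x x - outer z z"
  have E_S: "E \<in> S" unfolding E_def using S outer_S x zS by (simp add: subspace_diff)
  let ?G = "f' (outer x x)"
  have near: "\<bar>?G N - E \<bullet> N\<bar> \<le> \<delta> * norm E * norm N" if "N \<in> S" for N
    unfolding E_def
    by (rule restricted_gradient_near_identity[OF f' f'' S rip_S outer_S[OF zS] grad0
          outer_S[OF x] that])
  note crit = factored_local_min_conditions[OF f' f'' loc]
  define \<theta> where "\<theta> = ?G (outer w w)"
  define p where "p = x \<bullet> x"
  define r where "r = w \<bullet> w"
  have E: "E = (1 - \<beta>\<^sup>2) *\<^sub>R outer x x - \<beta> *\<^sub>R (outer x w + outer w x) - outer w w"
    by (simp add: E_def z outer_simps algebra_simps power2_eq_square)
  have GE: "?G E = - \<theta>"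
  proof -
    have "?G (outer x x) = 0" using crit(1)[of x] by (simp only: blinfun.add_right)
    then show ?thesis unfolding E \<theta>_def
      by (simp add: blinfun.diff_right blinfun.scaleR_right crit(1)[of w])
  qed
  have curvature: "- \<theta> \<le> (1 + \<delta>) * p * r"
  proof -
    let ?U = "outer x w + outer w x"
    have "?U \<in> S" using S outer_S x w by (simp add: subspace_add)
    then have "f'' (outer x x) ?U ?U \<le> (1 + \<delta>) * (norm ?U)\<^sup>2"
      using rip_S outer_S[OF x] by blast
    moreover have "(norm ?U)\<^sup>2 = 2 * (p * r)"
      by (simp add: power2_norm_eq_inner inner_simps inner_outer xw wx p_def r_def)
    ultimately show ?thesis using crit(2)[of w] by (simp add: \<theta>_def)
  qed
  have E2: "(norm E)\<^sup>2 = (p - \<beta>\<^sup>2 * p)\<^sup>2 + 2 * (\<beta>\<^sup>2 * p) * r + r\<^sup>2"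
    unfolding E
    by (simp add: power2_norm_eq_inner inner_simps inner_outer xw wx p_def r_def)
       (simp add: power2_eq_square algebra_simps)
  have "E = 0"
  proof (cases "w = 0")
    case True
    then have "\<theta> = 0" by (simp add: \<theta>_def outer_def blinfun.zero_right zero_vec_def[symmetric])
    then have "(norm E)\<^sup>2 \<le> \<delta> * (norm E)\<^sup>2"
      using near[OF E_S] GE by (simp add: power2_norm_eq_inner[symmetric] power2_eq_square mult_ac)
    then have "(1 - \<delta>) * (norm E)\<^sup>2 \<le> 0" by (simp add: algebra_simps)
    then show ?thesis using \<delta> by (simp add: mult_le_0_iff)
  next
    case False
    then have r: "r > 0" by (simp add: r_def)
    define g where "g = - \<theta> / r"
    have g: "g \<le> (1 + \<delta>) * p" using curvature r by (simp add: g_def field_simps)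
    \<comment> \<open>\<open>- (g / r) w w\<^sup>T\<close> represents \<open>f' (x x\<^sup>T)\<close> on the symmetric part of \<open>S\<close>, so that \<open>N\<close>
      is the deviation of the gradient from \<open>E\<close> and attains the norm of that deviation\<close>
    define N where "N = (- g / r) *\<^sub>R outer w w - E"
    have "N \<in> S" unfolding N_def
      by (intro subspace_diff[OF S] subspace_scale[OF S] outer_S w E_S)
    then have "?G N \<le> E \<bullet> N + \<delta> * norm E * norm N" using near by force
    moreover have "?G N = g\<^sup>2 - g * r"
      using r by (simp add: N_def blinfun.diff_right blinfun.scaleR_right GE \<theta>_def[symmetric] g_def
          power2_eq_square field_simps)
    moreover have "E \<bullet> outer w w = - r\<^sup>2"
      unfolding E by (simp add: inner_simps inner_outer xw r_def power2_eq_square)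
    then have EN: "E \<bullet> N = g * r - (norm E)\<^sup>2"
      using r by (simp add: N_def inner_simps dot_square_norm) (simp add: power2_eq_square)
    moreover have norm_w: "norm (outer w w) = r"
      by (simp add: norm_eq_sqrt_inner inner_outer r_def)
    moreover have "(norm (N + E))\<^sup>2 = g\<^sup>2"
      using r norm_w by (simp add: N_def)
    then have "(norm N)\<^sup>2 = g\<^sup>2 - 2 * g * r + (norm E)\<^sup>2"
      using EN by (simp add: power2_norm_eq_inner inner_simps inner_commute)
    moreover have "2 * (\<delta> * norm E * norm N) \<le> \<delta>\<^sup>2 * (norm E)\<^sup>2 + (norm N)\<^sup>2"
      using zero_le_power2[of "\<delta> * norm E - norm N"] by (simp add: power2_diff power_mult_distrib)
    ultimately have "g\<^sup>2 - 2 * g * r + (1 - \<delta>\<^sup>2) * (norm E)\<^sup>2 \<le> 0"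
      by (simp add: algebra_simps)
    with rank1_threshold[OF _ _ r \<delta> g, of "\<beta>\<^sup>2 * p"] show ?thesis
      unfolding E2 by (simp add: p_def)
  qed
  then show ?thesis by (simp add: E_def)
qed

theorem theorem9:
  fixes f :: "real^'n^'n \<Rightarrow> real"
    and Mstar :: "real^'n^'n"
    and \<delta> \<kappa> :: real
  assumes "twice_cont_differentiable f"
    and "sym_psd Mstar"
    and "rank Mstar \<le> 1"
    and "global_minimizer f Mstar"
    and "0 \<le> \<delta>" and "\<delta> < 1"
    and "0 \<le> \<kappa>"
    and "RIP2 \<delta> f"
    and "BDP2 \<kappa> f"
    and "\<delta> < (2 - 6 * (1 + sqrt 2) * \<kappa>) / (4 + 6 * (1 + sqrt 2) * \<kappa>)"
  shows "\<forall>x. local_minimizer (\<lambda>x. f (outer_self x)) x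
           \<longrightarrow> global_minimizer (\<lambda>x. f (outer_self x)) x"
proof (intro allI impI)
  fix x
  assume loc: "local_minimizer (\<lambda>x. f (outer_self x)) x"
  obtain z where z: "Mstar = outer z z"
    using sym_psd_rank1_outer assms(2,3) by blast
  define c where "c = 6 * (1 + sqrt 2) * \<kappa>"
  have "c \<ge> 0" using assms(7) by (simp add: c_def)
  then have "(2 - c) / (4 + c) \<le> 1/2" by (simp add: field_simps)
  then have "\<delta> < 1/2" using assms(10) unfolding c_def by linarith
  then have "outer x x = Mstar"
    using rank1_factored_local_min_exact[of f z \<delta> x] assms loc by (simp add: z outer_self_eq)
  then show "global_minimizer (\<lambda>x. f (outer_self x)) x"
    using assms(4) by (simp add: global_minimizer_def outer_self_eq)
qed

end
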